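(* Let $n\ge1$ and let $L_n$ be the linear hexagonal chain with vertices $p_0,\dots,p_n,q_0,\dots,q_n,u_0,\dots,u_{n-1},v_0,\dots,v_{n-1}$ and edges $p_iq_i$ $(0\le i\le n)$ and $p_iu_i,\ u_ip_{i+1},\ q_iv_i,\ v_iq_{i+1}$ $(0\le i\le n-1)$; let $r$ denote resistance distance in $L_n$. Then for any two distinct vertices $a,b$ of $L_n$, $$r(p_0,q_n)\ge r(a,b)\ge r(p_{\lfloor\frac n2\rfloor},q_{\lfloor\frac n2\rfloor}).$$
   Context: The resistance distance $r(a,b)$ is the effective resistance between $a$ and $b$ when each edge of the graph is a unit resistor. *)

theory Defs
  imports Complex_Main
begin

text \<open>
  A finite simple graph is given by a vertex set \<open>V\<close> and a set \<open>E\<close> of two-element subsets of \<open>V\<close>.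
  Every edge is a unit resistor, so by Ohm's law the current from \<open>x\<close> to \<open>y\<close> along an edge is the
  potential drop \<open>\<phi> x - \<phi> y\<close>.  By Kirchhoff's current law, \<open>\<phi>\<close> is a potential for a unit current
  entering the network at \<open>a\<close> and leaving it at \<open>b\<close> iff the net outflow along the edges is \<open>1\<close> at \<open>a\<close>,
  \<open>-1\<close> at \<open>b\<close>, and \<open>0\<close> at every other vertex (identically \<open>0\<close> if \<open>a = b\<close>).
\<close>

definition unit_current_potential ::
    "'a set \<Rightarrow> 'a set set \<Rightarrow> 'a \<Rightarrow> 'a \<Rightarrow> ('a \<Rightarrow> real) \<Rightarrow> bool" where
  "unit_current_potential V E a b \<phi> \<longleftrightarrow>
     (\<forall>x\<in>V. (\<Sum>y | y \<in> V \<and> {x, y} \<in> E. \<phi> x - \<phi> y) =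
        (if x = a then 1 else 0) - (if x = b then 1 else 0))"

text \<open>
  Effective resistance is voltage over current, here the potential difference under a unit current.
  The value does not depend on the potential (lemma \<open>resistance_distance_eqI\<close> below); potentials
  exist whenever \<open>a\<close> and \<open>b\<close> lie in the same component, and the description operator
  carries no information otherwise.
\<close>

definition resistance_distance :: "'a set \<Rightarrow> 'a set set \<Rightarrow> 'a \<Rightarrow> 'a \<Rightarrow> real" where
  "resistance_distance V E a b =
     (THE r. \<exists>\<phi>. unit_current_potential V E a b \<phi> \<and> r = \<phi> a - \<phi> b)"

lemma unit_current_potential_unique:
  assumes "finite V" "a \<in> V" "b \<in> V"
    and f: "unit_current_potential V E a b f" and g: "unit_current_potential V E a b g"
  shows "f a - f b = g a - g b"
proof -
  define c where "c x y = (if {x, y} \<in> E then 1 else 0 :: real)" for x y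
  have c_sym: "c x y = c y x" for x y
    by (simp add: c_def insert_commute)
  have *: "(\<Sum>x\<in>V. \<Sum>y\<in>V. c x y * (h x - h y) * k x) = k a - k b"
    if h: "unit_current_potential V E a b h" for h k
  proof -
    have "(\<Sum>y\<in>V. c x y * (h x - h y) * k x) =
        ((if x = a then 1 else 0) - (if x = b then 1 else 0)) * k x" if "x \<in> V" for x
    proof -
      have "(\<Sum>y\<in>V. c x y * (h x - h y)) = (\<Sum>y\<in>V. if {x, y} \<in> E then h x - h y else 0)"
        by (intro sum.cong) (auto simp: c_def)
      also have "\<dots> = (\<Sum>y | y \<in> V \<and> {x, y} \<in> E. h x - h y)"
        using \<open>finite V\<close> by (simp add: sum.inter_filter)
      finally show ?thesis
        using h that by (simp add: unit_current_potential_def flip: sum_distrib_right)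
    qed
    then have "(\<Sum>x\<in>V. \<Sum>y\<in>V. c x y * (h x - h y) * k x) =
        (\<Sum>x\<in>V. (if x = a then k x else 0) - (if x = b then k x else 0))"
      by (intro sum.cong) auto
    then show ?thesis
      using assms(1-3) by (simp add: sum_subtractf)
  qed
  have swap: "(\<Sum>x\<in>V. \<Sum>y\<in>V. c x y * h y * k x) = (\<Sum>x\<in>V. \<Sum>y\<in>V. c x y * k y * h x)"
    for h k :: "'a \<Rightarrow> real"
    by (subst sum.swap) (simp add: c_sym mult_ac)
  have "(\<Sum>x\<in>V. \<Sum>y\<in>V. c x y * (g x - g y) * f x) =
      (\<Sum>x\<in>V. \<Sum>y\<in>V. c x y * g x * f x) - (\<Sum>x\<in>V. \<Sum>y\<in>V. c x y * g y * f x)"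
    by (simp add: algebra_simps sum_subtractf)
  also have "\<dots> = (\<Sum>x\<in>V. \<Sum>y\<in>V. c x y * f x * g x) - (\<Sum>x\<in>V. \<Sum>y\<in>V. c x y * f y * g x)"
    by (subst swap) (simp add: mult_ac)
  also have "\<dots> = (\<Sum>x\<in>V. \<Sum>y\<in>V. c x y * (f x - f y) * g x)"
    by (simp add: algebra_simps sum_subtractf)
  finally show ?thesis
    using *[OF f, of g] *[OF g, of f] by simp
qed

lemma resistance_distance_eqI:
  assumes "finite V" "a \<in> V" "b \<in> V" "unit_current_potential V E a b \<phi>"
  shows "resistance_distance V E a b = \<phi> a - \<phi> b"
  unfolding resistance_distance_def
  using assms unit_current_potential_unique[OF assms(1-3)] by (intro the_equality) blast+

datatype hex_vertex = P nat | Q nat | U nat | V nat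

definition hex_vertices :: "nat \<Rightarrow> hex_vertex set" where
  "hex_vertices n = {P i |i. i \<le> n} \<union> {Q i |i. i \<le> n} \<union> {U i |i. i < n} \<union> {V i |i. i < n}"

definition hex_edges :: "nat \<Rightarrow> hex_vertex set set" where
  "hex_edges n = {{P i, Q i} |i. i \<le> n} \<union>
     {{P i, U i} |i. i < n} \<union> {{U i, P (i + 1)} |i. i < n} \<union>
     {{Q i, V i} |i. i < n} \<union> {{V i, Q (i + 1)} |i. i < n}"

abbreviation hex_resistance :: "nat \<Rightarrow> hex_vertex \<Rightarrow> hex_vertex \<Rightarrow> real" where
  "hex_resistance n \<equiv> resistance_distance (hex_vertices n) (hex_edges n)"

end

theory Submission imports Defs begin

text \<open>
  Give \<open>p\<^sub>i, q\<^sub>i\<close> the position \<open>2i\<close> and \<open>u\<^sub>i, v\<^sub>i\<close> the position \<open>2i + 1\<close>, and split potentials into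
  their even and odd parts under the reflection exchanging \<open>p, u\<close> with \<open>q, v\<close>.  The rungs carry no
  current in the even part, which is a potential on a path.  In the odd part the midpoints of the
  rungs have potential \<open>0\<close>, so it is a potential on the same path with every even position joined to
  ground by a conductance \<open>2\<close>.  With \<open>G\<close> the Green function of the grounded path, vertices at positions
  \<open>j, k\<close> have resistance distance \<open>(\<bar>j - k\<bar> + G(j,j) + G(k,k) \<mp> 2 G(j,k)) / 2\<close>, with minus on the same
  side and plus on opposite sides.

  If \<open>n \<ge> 1\<close>, then \<open>G(j,k) \<le> 5/12\<close> unless \<open>j = k\<close> is odd, \<open>G(j,j) \<le> 11/12\<close> for every \<open>j\<close>, and \<open>G(0,0) \<ge> 2/5\<close>.
  So the term \<open>\<bar>j - k\<bar>\<close> decides the maximum, up to a few positions near the ends.  For the minimum, pairs of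
  distinct positions lie far enough above \<open>2 G(m,m)\<close>, where \<open>m\<close> is the position of the middle rung, and
  among the rungs log-convexity of the solutions of the recurrence for \<open>G\<close> singles out the middle one.
\<close>

text \<open>
  The solution, normalised to \<open>1\<close> at position \<open>0\<close>, of Kirchhoff's law on the grounded path at every
  position except the right end: the coefficient is \<open>2 + 2\<close> at grounded positions and \<open>2\<close> at the others.
\<close>

fun rail :: "nat \<Rightarrow> real" where
  "rail 0 = 1"
| "rail (Suc 0) = 3"
| "rail (Suc (Suc k)) = (if even k then 2 else 4) * rail (Suc k) - rail k"

text \<open>The amount by which \<open>rail\<close> fails Kirchhoff's law at the grounded right end
  \<open>2 * n\<close>: for \<open>n > 0\<close> the recurrence turns it into
  \<open>3 * rail (2 * n) - rail (2 * n - 1)\<close>.\<close>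

definition rail_wronskian :: "nat \<Rightarrow> real" where
  "rail_wronskian n = rail (2 * n + 1) - rail (2 * n)"

text \<open>The usual product of a left and a right solution over their Wronskian. The right
  solution is \<open>rail\<close> reflected: \<open>2 * n\<close> is even, so reflection preserves
  the grounded positions.\<close>

definition green :: "nat \<Rightarrow> nat \<Rightarrow> nat \<Rightarrow> real" where
  "green n j k = rail (min j k) * rail (2 * n - max j k) / rail_wronskian n"

definition path_laplacian :: "nat \<Rightarrow> (nat \<Rightarrow> real) \<Rightarrow> nat \<Rightarrow> real" where
  "path_laplacian m h k =
     (if k < m then h k - h (k + 1) else 0) + (if 0 < k then h k - h (k - 1) else 0)"

fun hex_pos :: "hex_vertex \<Rightarrow> nat" where
  "hex_pos (P i) = 2 * i"
| "hex_pos (Q i) = 2 * i"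
| "hex_pos (U i) = 2 * i + 1"
| "hex_pos (V i) = 2 * i + 1"

fun hex_side :: "hex_vertex \<Rightarrow> real" where
  "hex_side (P i) = 1"
| "hex_side (Q i) = -1"
| "hex_side (U i) = 1"
| "hex_side (V i) = -1"

section \<open>Growth and cross products of \<open>rail\<close>\<close>

lemma rail_pos_mono: "0 < rail k \<and> rail k < rail (Suc k)"
  by (induction k) auto

lemma rail_pos: "0 < rail k"
  using rail_pos_mono by blast

lemma rail_mono: "j \<le> k \<Longrightarrow> rail j \<le> rail k"
  using lift_Suc_mono_le[of rail] rail_pos_mono less_imp_le by blast

lemma rail_wronskian_pos: "0 < rail_wronskian n"
  using rail_pos_mono[of "2 * n"] by (simp add: rail_wronskian_def)

text \<open>Ratio bounds obtained in turn from the recurrence: 3, then \<open>2 - 1/3 = 5/3\<close>,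
  then \<open>4 - 3/5 = 17/5\<close> away from the left end.\<close>

lemma rail_odd_ge: "3 * rail (2 * i) \<le> rail (2 * i + 1)"
proof (cases i)
  case (Suc k)
  then show ?thesis
    using rail_pos_mono[of "Suc (2 * k)"]
    by (simp del: rail.simps add: rail.simps(3)[of "Suc (2 * k)"])
qed simp

lemma rail_odd_le: "5 * rail (2 * i + 1) \<le> 3 * rail (2 * i + 2)"
  using rail_odd_ge[of i] by simp

lemma rail_odd_ge_interior:
  assumes "0 < i"
  shows "17 * rail (2 * i) \<le> 5 * rail (2 * i + 1)"
proof -
  obtain k where "i = Suc k"
    using assms by (auto simp: gr0_conv_Suc)
  then show ?thesis
    using rail_odd_le[of k] by (simp del: rail.simps add: rail.simps(3)[of "Suc (2 * k)"])
qed

text \<open>The left side depends only on \<open>i + k\<close>: in the induction step both indices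
  have the same parity, so their recurrences share one coefficient and its terms cancel.\<close>

lemma rail_cross:
  "odd (i + k) \<Longrightarrow>
     rail (Suc i) * rail (Suc k) - rail i * rail k = rail (i + k + 2) - rail (i + k + 1)"
proof (induction i arbitrary: k)
  case 0
  then show ?case by simp
next
  case (Suc i)
  then have parity: "even i = even k" and "odd (i + Suc k)"
    by auto
  with Suc.IH[of "Suc k"]
  have "rail (Suc i) * rail (Suc (Suc k)) - rail i * rail (Suc k) =
      rail (Suc i + k + 2) - rail (Suc i + k + 1)"
    by (simp del: rail.simps)
  moreover have "rail (Suc i) * rail (Suc (Suc k)) - rail i * rail (Suc k) =
      rail (Suc (Suc i)) * rail (Suc k) - rail (Suc i) * rail k"
    using parity by (simp add: rail.simps(3) algebra_simps)
  ultimately show ?case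
    by simp
qed

text \<open>The Wronskian of the solutions obeying Kirchhoff's law at the left and at the right end.\<close>

lemma rail_wronskian_eq:
  assumes "j < 2 * n"
  shows "rail (Suc j) * rail (2 * n - j) - rail j * rail (2 * n - Suc j) = rail_wronskian n"
proof -
  obtain k where k: "2 * n = Suc (j + k)"
    using assms less_imp_Suc_add by blast
  have "odd (Suc (Suc (j + k)))"
    unfolding k[symmetric] by simp
  then have "odd (j + k)"
    by simp
  then show ?thesis
    using rail_cross[of j k] k by (simp add: rail_wronskian_def del: rail.simps)
qed

section \<open>The Green function of the grounded path\<close>

lemma path_laplacian_rail:
  assumes "k < m"
  shows "path_laplacian m rail k + (if even k then 2 * rail k else 0) = 0"
  using assms by (cases k) (auto simp: path_laplacian_def)

lemma path_laplacian_cong: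
  assumes "k \<le> m" "h k = h' k" "k < m \<Longrightarrow> h (k + 1) = h' (k + 1)" "0 < k \<Longrightarrow> h (k - 1) = h' (k - 1)"
  shows "path_laplacian m h k = path_laplacian m h' k"
  using assms by (auto simp: path_laplacian_def)

lemma path_laplacian_mult: "path_laplacian m (\<lambda>x. c * h x) k = c * path_laplacian m h k"
  by (simp add: path_laplacian_def algebra_simps)

lemma path_laplacian_diff:
  "path_laplacian m (\<lambda>x. h x - h' x) k = path_laplacian m h k - path_laplacian m h' k"
  by (simp add: path_laplacian_def)

lemma path_laplacian_reflect:
  assumes "k \<le> m"
  shows "path_laplacian m (\<lambda>x. h (m - x)) k = path_laplacian m h (m - k)"
proof -
  have "m - (k - 1) = m - k + 1" if "0 < k"
    using that assms by simp
  moreover have "k < m \<longleftrightarrow> 0 < m - k" "m - k < m \<longleftrightarrow> 0 < k"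
    using assms by auto
  ultimately show ?thesis
    by (auto simp: path_laplacian_def)
qed

lemma green_sym: "green n j k = green n k j"
  by (simp add: green_def min.commute max.commute)

lemma green_reflect:
  assumes "j \<le> 2 * n" "k \<le> 2 * n"
  shows "green n (2 * n - j) (2 * n - k) = green n j k"
proof -
  have "min (2 * n - j) (2 * n - k) = 2 * n - max j k"
    and "2 * n - max (2 * n - j) (2 * n - k) = min j k"
    using assms by auto
  then show ?thesis
    by (simp add: green_def)
qed

lemma green_laplacian_less:
  assumes "k < j" "j \<le> 2 * n"
  shows "path_laplacian (2 * n) (green n j) k + (if even k then 2 * green n j k else 0) = 0"
proof -
  define c where "c = rail (2 * n - j) / rail_wronskian n"
  \<comment> \<open>This includes \<open>x = j\<close>, which may be the right neighbour of
    \<open>k\<close>.\<close>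
  have c: "green n j x = c * rail x" if "x \<le> j" for x
    using that by (simp add: green_def c_def min_absorb2 max_absorb1)
  have "path_laplacian (2 * n) (green n j) k = path_laplacian (2 * n) (\<lambda>x. c * rail x) k"
    using assms by (intro path_laplacian_cong) (auto simp: c)
  then show ?thesis
    using path_laplacian_rail[of k "2 * n"] assms
    by (auto simp: path_laplacian_mult c simp flip: distrib_left mult.left_commute[of c 2])
qed

text \<open>Right of the pole this follows by reflection. At the pole, Kirchhoff's law for
  \<open>rail\<close> turns the outflow, times \<open>W\<close>, into the Wronskian; at the right
  end it is the failure of that law.\<close>

lemma green_laplacian:
  assumes "j \<le> 2 * n" "k \<le> 2 * n"
  shows "path_laplacian (2 * n) (green n j) k + (if even k then 2 * green n j k else 0) =
    (if k = j then 1 else 0)"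
proof (cases k j rule: linorder_cases)
  case less
  then show ?thesis
    using green_laplacian_less[OF less assms(1)] by simp
next
  case greater
  have "path_laplacian (2 * n) (green n j) k =
      path_laplacian (2 * n) (\<lambda>x. green n (2 * n - j) (2 * n - x)) k"
    by (intro path_laplacian_cong green_reflect[symmetric]; use assms in simp)
  also have "\<dots> = path_laplacian (2 * n) (green n (2 * n - j)) (2 * n - k)"
    using assms(2) by (rule path_laplacian_reflect)
  finally show ?thesis
    using green_laplacian_less[of "2 * n - k" "2 * n - j" n] assms greater
    by (auto simp: green_reflect)
next
  case equal
  define W where "W = rail_wronskian n"
  have W: "0 < W"
    by (simp add: W_def rail_wronskian_pos)
  have "W * (path_laplacian (2 * n) (green n j) j + (if even j then 2 * green n j j else 0)) = W"
  proof (cases "j < 2 * n")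
    case True
    then have cross: "rail (Suc j) * rail (2 * n - j) - rail j * rail (2 * n - Suc j) = W"
      by (simp add: W_def rail_wronskian_eq)
    show ?thesis
    proof (cases j)
      case 0
      then show ?thesis
        using True W cross
        by (simp add: path_laplacian_def green_def flip: W_def) (simp add: field_simps)
    next
      case (Suc i)
      then show ?thesis
        using True W cross
        by (simp add: path_laplacian_def green_def min_absorb2 max_absorb1 min_absorb1 max_absorb2
            flip: W_def) (auto simp: field_simps)
    qed
  next
    case False
    then have j: "j = 2 * n"
      using assms by simp
    show ?thesis
    proof (cases n)
      case 0
      then show ?thesis
        using j by (simp add: path_laplacian_def green_def W_def rail_wronskian_def)
    next
      case (Suc i)
      then have "0 < n" and eq: "W = 3 * rail (2 * n) - rail (2 * n - 1)"
        by (simp_all add: W_def rail_wronskian_def)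
      have "W * (path_laplacian (2 * n) (green n j) j + (if even j then 2 * green n j j else 0)) =
          3 * rail (2 * n) - rail (2 * n - 1)"
        using j W \<open>0 < n\<close>
        by (simp add: path_laplacian_def green_def min_absorb2 max_absorb1 min_absorb1 max_absorb2
            del: rail.simps(2,3) flip: W_def) (simp add: field_simps)
      then show ?thesis
        using eq by simp
    qed
  qed
  then show ?thesis
    using W equal by (simp split: if_splits)
qed

text \<open>A unit current enters at \<open>j\<close> and half of it leaves at each end; the end
  terms are independent of \<open>j\<close> and cancel in differences.\<close>

lemma path_laplacian_abs:
  assumes "j \<le> m" "k \<le> m"
  shows "path_laplacian m (\<lambda>x. - \<bar>real x - real j\<bar> / 2) k =
    (if k = j then 1 else 0) - (if k = 0 then 1 / 2 else 0) - (if k = m then 1 / 2 else 0)"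
proof -
  let ?h = "\<lambda>x. - \<bar>real x - real j\<bar> / 2"
  have "?h k - ?h (k + 1) = (if k < j then - 1 / 2 else 1 / 2)"
    by (auto simp: field_simps)
  moreover have "?h k - ?h (k - 1) = (if k \<le> j then 1 / 2 else - 1 / 2)" if "0 < k"
    using that by (cases k) (auto simp: field_simps)
  ultimately show ?thesis
    using assms by (auto simp: path_laplacian_def)
qed

section \<open>Potentials and resistances on the hexagonal chain\<close>

lemma finite_hex_vertices: "finite (hex_vertices n)"
  by (simp add: hex_vertices_def)

lemma hex_vertices_iff: "x \<in> hex_vertices n \<longleftrightarrow> hex_pos x \<le> 2 * n"
  by (cases x) (auto simp: hex_vertices_def)

lemma hex_vertex_eqI: "hex_pos x = hex_pos y \<Longrightarrow> hex_side x = hex_side y \<Longrightarrow> x = y"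
  by (cases x; cases y; simp; presburger)

lemma hex_edge_iff:
  "{P i, P k} \<notin> hex_edges n" "{Q i, Q k} \<notin> hex_edges n"
  "{U i, U k} \<notin> hex_edges n" "{V i, V k} \<notin> hex_edges n"
  "{P i, V k} \<notin> hex_edges n" "{V k, P i} \<notin> hex_edges n"
  "{Q i, U k} \<notin> hex_edges n" "{U k, Q i} \<notin> hex_edges n"
  "{U i, V k} \<notin> hex_edges n" "{V k, U i} \<notin> hex_edges n"
  "{P i, Q k} \<in> hex_edges n \<longleftrightarrow> i = k \<and> i \<le> n"
  "{Q k, P i} \<in> hex_edges n \<longleftrightarrow> i = k \<and> i \<le> n"
  "{P i, U k} \<in> hex_edges n \<longleftrightarrow> k < n \<and> (i = k \<or> i = Suc k)"
  "{U k, P i} \<in> hex_edges n \<longleftrightarrow> k < n \<and> (i = k \<or> i = Suc k)"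
  "{Q i, V k} \<in> hex_edges n \<longleftrightarrow> k < n \<and> (i = k \<or> i = Suc k)"
  "{V k, Q i} \<in> hex_edges n \<longleftrightarrow> k < n \<and> (i = k \<or> i = Suc k)"
  by (auto simp: hex_edges_def doubleton_eq_iff)

lemma hex_neighbours:
  "i \<le> n \<Longrightarrow> {y. y \<in> hex_vertices n \<and> {P i, y} \<in> hex_edges n} =
     insert (Q i) ((if i < n then {U i} else {}) \<union> (if 0 < i then {U (i - 1)} else {}))"
  "i \<le> n \<Longrightarrow> {y. y \<in> hex_vertices n \<and> {Q i, y} \<in> hex_edges n} =
     insert (P i) ((if i < n then {V i} else {}) \<union> (if 0 < i then {V (i - 1)} else {}))"
  "i < n \<Longrightarrow> {y. y \<in> hex_vertices n \<and> {U i, y} \<in> hex_edges n} = {P i, P (i + 1)}"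
  "i < n \<Longrightarrow> {y. y \<in> hex_vertices n \<and> {V i, y} \<in> hex_edges n} = {Q i, Q (i + 1)}"
  by (rule set_eqI, case_tac x; auto simp: hex_vertices_iff hex_edge_iff)+

text \<open>Edges along the path keep the side. Across a rung \<open>A\<close> cancels and the drop
  is \<open>2 * hex_side x * B\<close>, whence the ground conductance 2.\<close>

lemma hex_net_outflow:
  assumes "x \<in> hex_vertices n" and \<phi>: "\<And>z. \<phi> z = A (hex_pos z) + hex_side z * B (hex_pos z)"
  shows "(\<Sum>y | y \<in> hex_vertices n \<and> {x, y} \<in> hex_edges n. \<phi> x - \<phi> y) =
    path_laplacian (2 * n) A (hex_pos x) +
    hex_side x * (path_laplacian (2 * n) B (hex_pos x) +
      (if even (hex_pos x) then 2 * B (hex_pos x) else 0))"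
proof -
  show ?thesis
  proof (cases x)
    case (P i)
    then have "i \<le> n"
      using assms by (simp add: hex_vertices_iff)
    with P show ?thesis
      by (cases i) (auto simp: hex_neighbours path_laplacian_def \<phi>)
  next
    case (Q i)
    then have "i \<le> n"
      using assms by (simp add: hex_vertices_iff)
    with Q show ?thesis
      by (cases i) (auto simp: hex_neighbours path_laplacian_def \<phi>)
  next
    case (U i)
    then have "i < n"
      using assms by (simp add: hex_vertices_iff)
    with U show ?thesis
      by (simp add: hex_neighbours path_laplacian_def \<phi>)
  next
    case (V i)
    then have "i < n"
      using assms by (simp add: hex_vertices_iff)
    with V show ?thesis
      by (simp add: hex_neighbours path_laplacian_def \<phi>)
  qed
qed

lemma hex_resistance_eq:
  assumes a: "a \<in> hex_vertices n" and b: "b \<in> hex_vertices n"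
  defines "j \<equiv> hex_pos a" and "k \<equiv> hex_pos b"
  shows "hex_resistance n a b = (\<bar>real j - real k\<bar> + green n j j + green n k k
    - 2 * (hex_side a * hex_side b) * green n j k) / 2"
proof -
  \<comment> \<open>Even and odd parts each carry half of the source, whence the factor
    \<open>1 / 2\<close>.\<close>
  define A where "A = (\<lambda>x. 1 / 2 * (- \<bar>real x - real j\<bar> / 2 - - \<bar>real x - real k\<bar> / 2))"
  define B where "B = (\<lambda>x. 1 / 2 * (hex_side a * green n j x - hex_side b * green n k x))"
  define \<phi> where "\<phi> z = A (hex_pos z) + hex_side z * B (hex_pos z)" for z
  have jk: "j \<le> 2 * n" "k \<le> 2 * n"
    using a b by (auto simp: j_def k_def hex_vertices_iff)
  have side: "hex_side z * hex_side z = 1" for z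
    by (cases z) auto
  have side': "hex_side z = 1 \<or> hex_side z = -1" for z
    by (cases z) auto
  have "unit_current_potential (hex_vertices n) (hex_edges n) a b \<phi>"
    unfolding unit_current_potential_def
  proof
    fix x assume x: "x \<in> hex_vertices n"
    define l where "l = hex_pos x"
    have l: "l \<le> 2 * n"
      using x by (simp add: l_def hex_vertices_iff)
    have lapA: "path_laplacian (2 * n) A l = ((if l = j then 1 else 0) - (if l = k then 1 else 0)) / 2"
      unfolding A_def path_laplacian_mult path_laplacian_diff
        path_laplacian_abs[OF jk(1) l] path_laplacian_abs[OF jk(2) l]
      by simp
    have "path_laplacian (2 * n) B l + (if even l then 2 * B l else 0) =
      (hex_side a * (path_laplacian (2 * n) (green n j) l + (if even l then 2 * green n j l else 0)) -
       hex_side b * (path_laplacian (2 * n) (green n k) l + (if even l then 2 * green n k l else 0))) / 2"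
      unfolding B_def path_laplacian_mult path_laplacian_diff by (simp add: algebra_simps)
    also have "\<dots> = (hex_side a * (if l = j then 1 else 0) - hex_side b * (if l = k then 1 else 0)) / 2"
      using jk l by (simp add: green_laplacian)
    finally have lapB: "path_laplacian (2 * n) B l + (if even l then 2 * B l else 0) =
      (hex_side a * (if l = j then 1 else 0) - hex_side b * (if l = k then 1 else 0)) / 2" .
    \<comment> \<open>The factor \<open>(1 + hex_side x * hex_side z) / 2\<close> is the indicator
      of equal sides, so the two halves recombine to a source at one vertex.\<close>
    have eq: "(1 + hex_side x * hex_side z) / 2 * (if l = hex_pos z then 1 else 0) =
        (if x = z then 1 else 0)" for z
      using hex_vertex_eqI[of x z] side'[of x] side'[of z] by (auto simp: l_def)
    have "(\<Sum>y | y \<in> hex_vertices n \<and> {x, y} \<in> hex_edges n. \<phi> x - \<phi> y) =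
        path_laplacian (2 * n) A l +
        hex_side x * (path_laplacian (2 * n) B l + (if even l then 2 * B l else 0))"
      using hex_net_outflow[OF x, of \<phi> A B] by (simp add: \<phi>_def l_def)
    also have "\<dots> = (1 + hex_side x * hex_side a) / 2 * (if l = j then 1 else 0)
        - (1 + hex_side x * hex_side b) / 2 * (if l = k then 1 else 0)"
      unfolding lapA lapB by (simp add: field_simps)
    also have "\<dots> = (if x = a then 1 else 0) - (if x = b then 1 else 0)"
      unfolding j_def k_def eq ..
    finally show "(\<Sum>y | y \<in> hex_vertices n \<and> {x, y} \<in> hex_edges n. \<phi> x - \<phi> y) =
        (if x = a then 1 else 0) - (if x = b then 1 else 0)" .
  qed
  then have "hex_resistance n a b = \<phi> a - \<phi> b"
    using a b finite_hex_vertices by (intro resistance_distance_eqI)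
  also have "\<dots> = (\<bar>real j - real k\<bar> + (hex_side a * hex_side a) * green n j j
      + (hex_side b * hex_side b) * green n k k - 2 * (hex_side a * hex_side b) * green n j k) / 2"
    by (simp add: \<phi>_def A_def B_def green_sym[of n k j] abs_minus_commute[of "real k" "real j"]
        flip: j_def k_def) (simp add: field_simps)
  finally show ?thesis
    by (simp add: side)
qed

section \<open>Bounds on the Green function\<close>

lemma green_pos: "0 < green n j k"
  by (simp add: green_def rail_pos rail_wronskian_pos)

lemma green_mono:
  assumes "min j k \<le> min j' k'" "max j' k' \<le> max j k"
  shows "green n j k \<le> green n j' k'"
proof -
  have "rail (min j k) * rail (2 * n - max j k) \<le> rail (min j' k') * rail (2 * n - max j' k')"
    by (intro mult_mono rail_mono diff_le_mono2 assms less_imp_le[OF rail_pos])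
  then show ?thesis
    unfolding green_def by (rule divide_right_mono[OF _ less_imp_le[OF rail_wronskian_pos]])
qed

lemma green_le_diag: "green n j k \<le> green n j j" "green n j k \<le> green n k k"
  by (rule green_mono; simp)+

text \<open>By the Wronskian identity the reciprocal is
  \<open>rail (2 * i + 1) / x - rail (2 * n - 2 * i - 1) / y\<close>, at least
  \<open>3 - 3/5 = 12/5\<close>, and \<open>17/5 - 3/5 = 14/5\<close> if
  \<open>0 < i\<close>.\<close>

lemma green_rung_bounds:
  assumes "i < n"
  shows "green n (2 * i) (2 * i) \<le> 5 / 12"
    and "0 < i \<Longrightarrow> green n (2 * i) (2 * i) \<le> 5 / 14"
proof -
  define x where "x = rail (2 * i)"
  define y where "y = rail (2 * n - 2 * i)"
  obtain m where m: "n = Suc (i + m)"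
    using assms less_imp_Suc_add by blast
  have W: "rail_wronskian n = rail (2 * i + 1) * y - x * rail (2 * n - Suc (2 * i))"
    using rail_wronskian_eq[of "2 * i" n] assms by (simp add: x_def y_def)
  have xy: "0 < x" "0 < y"
    by (auto simp: x_def y_def rail_pos)
  have "5 * rail (2 * n - Suc (2 * i)) \<le> 3 * y"
    using rail_odd_le[of m] by (simp add: m y_def del: rail.simps)
  then have upper: "x * (5 * rail (2 * n - Suc (2 * i))) \<le> x * (3 * y)"
    using xy by (intro mult_left_mono) auto
  have green: "green n (2 * i) (2 * i) = x * y / rail_wronskian n"
    by (simp add: green_def x_def y_def)
  have "3 * x * y \<le> rail (2 * i + 1) * y"
    using rail_odd_ge[of i] xy by (intro mult_right_mono) (auto simp: x_def)
  then show "green n (2 * i) (2 * i) \<le> 5 / 12"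
    using upper rail_wronskian_pos[of n] unfolding green by (simp add: W divide_simps)
  assume "0 < i"
  then have "17 * x * y \<le> 5 * rail (2 * i + 1) * y"
    using rail_odd_ge_interior[of i] xy by (intro mult_right_mono) (auto simp: x_def)
  then show "green n (2 * i) (2 * i) \<le> 5 / 14"
    using upper rail_wronskian_pos[of n] unfolding green by (simp add: W divide_simps)
qed

lemma green_rung_le:
  assumes "1 \<le> n" "i \<le> n"
  shows "green n (2 * i) (2 * i) \<le> 5 / 12"
proof (cases "i < n")
  case False
  then have "green n (2 * i) (2 * i) = green n 0 0"
    using assms green_reflect[of 0 n 0] by simp
  then show ?thesis
    using green_rung_bounds(1)[of 0 n] assms by simp
qed (rule green_rung_bounds)

text \<open>An even index gives a dominating diagonal value at a rung; two distinct odd positions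
  have a rung between them, whose diagonal value dominates.\<close>

lemma green_offdiag_le:
  assumes "1 \<le> n" "j \<le> 2 * n" "k \<le> 2 * n" "even j \<or> j \<noteq> k"
  shows "green n j k \<le> 5 / 12"
proof -
  have *: "green n l l \<le> 5 / 12" if "even l" "l \<le> 2 * n" for l
    using that green_rung_le[OF assms(1)] by (auto elim!: evenE)
  consider "even j" | "even k" | "odd j" "j < k" | "odd k" "k < j"
    using assms(4) nat_neq_iff by blast
  then show ?thesis
  proof cases
    case 1
    then show ?thesis
      using *[of j] green_le_diag(1)[of n j k] assms by simp
  next
    case 2
    then show ?thesis
      using *[of k] green_le_diag(2)[of n j k] assms by simp
  next
    case 3
    then have "green n j k \<le> green n (j + 1) (j + 1)"
      by (intro green_mono) auto
    then show ?thesis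
      using *[of "j + 1"] 3 assms by simp
  next
    case 4
    then have "green n j k \<le> green n (k + 1) (k + 1)"
      by (intro green_mono) auto
    then show ?thesis
      using *[of "k + 1"] 4 assms by simp
  qed
qed

lemma green_odd:
  assumes "odd j" "j < 2 * n" "k \<le> 2 * n"
  shows "green n j k = (green n (j - 1) k + green n (j + 1) k) / 2 + (if j = k then 1 / 2 else 0)"
proof -
  have "0 < j"
    using assms(1) by (auto intro: Nat.gr0I)
  then show ?thesis
    using green_laplacian[of k n j] assms
    unfolding green_sym[of n j k] green_sym[of n "j - 1" k] green_sym[of n "j + 1" k]
    by (auto simp: path_laplacian_def field_simps split: if_splits)
qed

text \<open>Averaging at the ungrounded position \<open>j\<close>, in both arguments.\<close>

lemma green_odd_diag:
  assumes "odd j" "j < 2 * n"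
  shows "4 * green n j j = 2 + green n (j - 1) (j - 1) + green n (j + 1) (j + 1)
    + 2 * green n (j - 1) (j + 1)"
proof -
  obtain l where l: "j = Suc l"
    using assms(1) by (cases j) auto
  have odd: "green n (Suc l) k = (green n l k + green n (Suc (Suc l)) k) / 2 +
      (if Suc l = k then 1 / 2 else 0)" if "k \<le> 2 * n" for k
    using green_odd[OF assms that] by (simp add: l)
  have mid: "green n (Suc l) (Suc l) =
      (green n (Suc l) l + green n (Suc l) (Suc (Suc l))) / 2 + 1 / 2"
    using odd[of "Suc l"] assms(2) l green_sym[of n l "Suc l"] green_sym[of n "Suc (Suc l)" "Suc l"]
    by simp
  have left: "green n (Suc l) l = (green n l l + green n l (Suc (Suc l))) / 2"
    using odd[of l] assms(2) l green_sym[of n "Suc (Suc l)" l] by simp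
  have right: "green n (Suc l) (Suc (Suc l)) =
      (green n l (Suc (Suc l)) + green n (Suc (Suc l)) (Suc (Suc l))) / 2"
    using odd[of "Suc (Suc l)"] assms(2) l by simp
  show ?thesis
    using mid unfolding left right by (simp add: l field_simps)
qed

text \<open>At odd positions the averaging identity gives \<open>4 * green n j j\<close> at most
  \<open>2 + 4 * 5/12 = 11/3\<close>.\<close>

lemma green_diag_le:
  assumes "1 \<le> n" "j \<le> 2 * n"
  shows "green n j j \<le> 11 / 12"
proof (cases "even j")
  case True
  then show ?thesis
    using green_offdiag_le[of n j j] assms by simp
next
  case False
  then have j: "j < 2 * n" "j - 1 \<le> 2 * n"
    using assms by (cases "j = 2 * n"; force)+
  then show ?thesis
    using green_odd_diag[OF False j(1)] green_offdiag_le[of n "j - 1" "j - 1"]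
      green_offdiag_le[of n "j + 1" "j + 1"] green_offdiag_le[of n "j - 1" "j + 1"] assms False j
    by simp
qed

text \<open>The value is \<open>rail (2 * n) / rail_wronskian n\<close>, and for
  \<open>n > 0\<close> the Wronskian is at most \<open>(3 - 1/2) * rail (2 * n)\<close>.\<close>

lemma green_end_ge: "2 / 5 \<le> green n 0 0"
proof (cases n)
  case 0
  then show ?thesis
    by (simp add: green_def rail_wronskian_def)
next
  case (Suc m)
  have "rail (2 * n - 1) \<ge> rail (2 * n) / 2"
    using rail_pos[of "2 * m"] by (simp add: Suc)
  moreover have "rail_wronskian n = 3 * rail (2 * n) - rail (2 * n - 1)"
    using rail_wronskian_eq[of 0 n] Suc by simp
  ultimately show ?thesis
    using rail_wronskian_pos[of n] by (simp add: green_def divide_simps)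
qed

section \<open>The maximum\<close>

lemma opposite_resistance_le:
  assumes n: "1 \<le> n" and jk: "j \<le> 2 * n" "k \<le> 2 * n"
  shows "\<bar>real j - real k\<bar> + green n j j + green n k k + 2 * green n j k \<le>
    2 * n + 2 * green n 0 0 + 2 * green n 0 (2 * n)"
  using jk
proof (induction j k rule: linorder_wlog)
  case (sym j k)
  then show ?case
    by (simp add: green_sym[of n k j] abs_minus_commute)
next
  case (le j k)
  have ends: "green n (2 * n) (2 * n) = green n 0 0"
    using green_reflect[of 0 n 0] by simp
  have pos: "0 < green n 0 (2 * n)"
    by (rule green_pos)
  show ?case
  proof (cases "j = k")
    case eq: True
    show ?thesis
    proof (cases "even j")
      case True
      then show ?thesis
        using eq le n green_offdiag_le[of n j j] green_end_ge[of n] pos by simp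
    next
      case False
      then have j: "0 < j" "j < 2 * n"
        using le by (auto simp: eq intro: Nat.gr0I le_neq_implies_less)
      show ?thesis
      proof (cases "n = 1")
        \<comment> \<open>Equality holds here: in a single hexagon \<open>U 0\<close>,
          \<open>V 0\<close> are antipodal, as are \<open>P 0\<close>, \<open>Q 1\<close>.\<close>
        case True
        then have "j = 1"
          using j by simp
        then show ?thesis
          using green_odd_diag[OF False j(2)] eq ends True
          by (simp add: numeral_2_eq_2)
      next
        case n2: False
        have "j - 1 \<le> 2 * n" "1 \<le> real n - 1"
          using n2 n j by auto
        then show ?thesis
          using green_odd_diag[OF False j(2)] eq n j False
            green_offdiag_le[of n "j - 1" "j - 1"] green_offdiag_le[of n "j + 1" "j + 1"]
            green_offdiag_le[of n "j - 1" "j + 1"] green_end_ge[of n] pos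
          by simp
      qed
    qed
  next
    case neq: False
    define d where "d = k - j"
    have d: "\<bar>real j - real k\<bar> = real d" "k = j + d"
      using le by (auto simp: d_def)
    have off: "green n j k \<le> 5 / 12"
      using green_offdiag_le[of n j k] le n neq by simp
    consider "even j" "even k" | "odd j" "odd k" | "odd j \<longleftrightarrow> even k"
      by blast
    then show ?thesis
    proof cases
      case 1
      show ?thesis
      proof (cases "d = 2 * n")
        case True
        then show ?thesis
          using d le ends by simp
      next
        case False
        have "even d"
          using 1 d by simp
        then have "d + 2 \<le> 2 * n"
          using False d le by (auto elim!: evenE)
        then show ?thesis
          using off green_offdiag_le[of n j j] green_offdiag_le[of n k k] 1 le n pos
            green_end_ge[of n] d by simp
      qed
    next
      case 2
      then have "0 < j" "k \<noteq> 2 * n"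
        using odd_pos by auto
      \<comment> \<open>The left side is at most \<open>d + 8/3\<close>, hence at most
        \<open>2 * n + 2/3\<close>, while the right side exceeds \<open>2 * n + 4/5\<close>.\<close>
      then have "d + 2 \<le> 2 * n"
        using d le by simp
      then show ?thesis
        using off green_diag_le[of n j] green_diag_le[of n k] le n pos green_end_ge[of n] d by simp
    next
      case 3
      have sum: "green n j j + green n k k \<le> 5 / 12 + 11 / 12"
        using 3 green_offdiag_le[of n j j] green_offdiag_le[of n k k]
          green_diag_le[of n j] green_diag_le[of n k] le n by (cases "even j") auto
      have "odd d"
        using 3 d by auto
      then have "d \<noteq> 2 * n" "d \<noteq> 2 * n - 2"
        by auto
      \<comment> \<open>For \<open>d = 2 * n - 1\<close> the crude bound \<open>2 * n + 7/6\<close>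
        is too weak. Averaging at the odd position produces one copy of
        \<open>green n 0 (2 * n)\<close>; after cancelling it and one \<open>green n 0 0\<close>, it
        remains that \<open>-1 + 11/12 + 5/12 = 1/3\<close> is below \<open>2/5\<close>.\<close>
      then consider "d + 3 \<le> 2 * n" | "j = 1" "k = 2 * n" | "j = 0" "k = 2 * n - 1"
        using d le by linarith
      then show ?thesis
      proof cases
        case 1
        then show ?thesis
          using sum off pos green_end_ge[of n] d by simp
      next
        case 2
        then show ?thesis
          using green_odd[of 1 n "2 * n"] green_offdiag_le[of n "Suc (Suc 0)" "2 * n"] green_diag_le[of n 1]
            n pos green_end_ge[of n] ends by simp
      next
        case 3
        have "odd (2 * n - 1)" "2 * n - 1 - 1 = 2 * n - 2" "2 * n - 1 + 1 = 2 * n"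
          using n by auto
        then show ?thesis
          using green_odd[of "2 * n - 1" n 0] green_offdiag_le[of n "2 * n - 2" 0] 3
            green_diag_le[of n "2 * n - 1"] n pos green_end_ge[of n]
            green_sym[of n 0 "2 * n - 1"] green_sym[of n 0 "2 * n"]
          by simp
      qed
    qed
  qed
qed

section \<open>The minimum\<close>

lemma rail_even_recurrence: "rail (2 * i + 4) = 6 * rail (2 * i + 2) - rail (2 * i)"
proof -
  have "2 * i + 4 = Suc (Suc (Suc (Suc (2 * i))))"
    by simp
  then show ?thesis
    by (simp only:) simp
qed

text \<open>Since the even recurrence has constant coefficients, the difference of the two sides
  does not depend on \<open>i\<close>; at \<open>i = 0\<close> it is the growth by a factor of at
  least 5.\<close>

lemma rail_even_log_convex:
  "rail (2 * i + 2) * rail (2 * (i + d)) \<le> rail (2 * i) * rail (2 * (i + d) + 2)"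
proof (induction i)
  case 0
  have "5 * rail (2 * d) \<le> rail (2 * d + 2)"
    using rail_odd_ge[of d] by simp
  then show ?case
    by (simp add: eval_nat_numeral)
next
  case (Suc i)
  have "rail (2 * i + 4) * rail (2 * (i + d) + 2) \<le> rail (2 * i + 2) * rail (2 * (i + d) + 4)"
    using Suc unfolding rail_even_recurrence by (simp add: algebra_simps del: rail.simps)
  then show ?case
    by (simp add: eval_nat_numeral del: rail.simps)
qed

text \<open>By log-convexity, bringing two indices of fixed sum closer together does not increase
  the product.\<close>

lemma rail_even_prod_antimono:
  assumes "i \<le> m" "2 * m \<le> n"
  shows "rail (2 * m) * rail (2 * (n - m)) \<le> rail (2 * i) * rail (2 * (n - i))"
  using assms
proof (induction m rule: dec_induct)
  case base
  then show ?case by simp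
next
  case (step m)
  define d where "d = n - Suc m - m"
  have d: "n - Suc m = m + d" "n - m = m + d + 1"
    using step.prems by (auto simp: d_def)
  have "rail (2 * Suc m) * rail (2 * (n - Suc m)) \<le> rail (2 * m) * rail (2 * (n - m))"
    using rail_even_log_convex[of m d] unfolding d by (simp del: rail.simps)
  then show ?case
    using step by simp
qed

lemma green_rung_ge_middle:
  assumes "i \<le> n"
  shows "green n (2 * (n div 2)) (2 * (n div 2)) \<le> green n (2 * i) (2 * i)"
proof -
  have *: "green n (2 * (n div 2)) (2 * (n div 2)) \<le> green n (2 * i) (2 * i)"
    if "i \<le> n div 2" for i
    using rail_even_prod_antimono[OF that, of n] rail_wronskian_pos[of n]
    by (simp add: green_def divide_right_mono right_diff_distrib')
  show ?thesis
  proof (cases "i \<le> n div 2")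
    case False
    then have "n - i \<le> n div 2"
      by simp
    then show ?thesis
      using *[of "n - i"] green_reflect[of "2 * i" n "2 * i"] assms
      by (simp add: right_diff_distrib')
  qed (rule *)
qed

lemma middle_le_distinct_positions:
  assumes n: "1 \<le> n" and jk: "j \<le> 2 * n" "k \<le> 2 * n" "j \<noteq> k"
  shows "4 * green n (2 * (n div 2)) (2 * (n div 2)) \<le>
    \<bar>real j - real k\<bar> + green n j j + green n k k - 2 * green n j k"
proof -
  define M where "M = green n (2 * (n div 2)) (2 * (n div 2))"
  have M: "M \<le> 5 / 12"
    using green_rung_le[OF n, of "n div 2"] by (simp add: M_def)
  \<comment> \<open>For \<open>n = 1\<close> this is an equality, as all edges of a hexagon are alike; for \<open>n \<ge> 2\<close> the middle rung
    has neighbours on both sides, which gives the better bound \<open>5/14\<close>.\<close>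
  have adjacent: "4 * M \<le> 1 + green n l l + green n m m - 2 * green n l m"
    if "odd l" "l < 2 * n" "m = l - 1 \<or> m = l + 1" for l m
  proof -
    have "0 < l"
      using that(1) by (auto intro: Nat.gr0I)
    define A where "A = green n (l - 1) (l - 1)"
    define B where "B = green n (l + 1) (l + 1)"
    define C where "C = green n (l - 1) (l + 1)"
    have C: "C \<le> A" "C \<le> B"
      using green_le_diag[of n "l - 1" "l + 1"] by (auto simp: A_def B_def C_def)
    have "4 * green n l l = 2 + A + B + 2 * C"
      using green_odd_diag[OF that(1,2)] by (simp add: A_def B_def C_def)
    moreover have "2 * green n l m = green n m m + C"
      using that green_odd[OF that(1,2), of m] \<open>0 < l\<close>
      by (auto simp: C_def green_sym[of n "Suc l" "l - Suc 0"])
    \<comment> \<open>As \<open>C \<le> A\<close> and \<open>C \<le> B\<close>, this is at least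
      \<open>3/2\<close>. The bound \<open>5/14\<close> suffices, since
      \<open>4 * 5/14 = 10/7\<close>, but \<open>5/12\<close> would not.\<close>
    ultimately have eq: "1 + green n l l + green n m m - 2 * green n l m = 3 / 2 + (A + B) / 4 - C / 2"
      by (simp add: field_simps)
    show ?thesis
    proof (cases "n = 1")
      case True
      then have "l = 1"
        using that(2) \<open>0 < l\<close> by simp
      then show ?thesis
        using True eq M by (simp add: A_def B_def C_def green_def rail_wronskian_def eval_nat_numeral)
    next
      case False
      then have "M \<le> 5 / 14"
        using green_rung_bounds(2)[of "n div 2" n] n by (simp add: M_def)
      then show ?thesis
        using eq C by (simp add: field_simps)
    qed
  qed
  show ?thesis
  proof (cases "\<bar>real j - real k\<bar> < 2")
    \<comment> \<open>The distance is at least 2, the Green terms sum to at least 0, and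
      \<open>4 * M \<le> 5/3\<close>.\<close>
    case False
    then show ?thesis
      using green_le_diag[of n j k] M by (simp add: M_def)
  next
    case True
    then have dist: "j = k + 1 \<or> k = j + 1"
      using jk(3) by auto
    show ?thesis
    proof (cases "odd j")
      case True
      then have "j < 2 * n"
        using jk by (auto intro: le_neq_implies_less)
      then show ?thesis
        using adjacent[of j k] True dist by (auto simp: M_def)
    next
      case False
      then have "odd k"
        using dist by auto
      moreover from this have "k < 2 * n"
        using jk by (auto intro: le_neq_implies_less)
      ultimately show ?thesis
        using adjacent[of k j] dist by (auto simp: M_def green_sym[of n k j])
    qed
  qed
qed

theorem theorem3p5:
  fixes n :: nat and a b :: hex_vertex
  assumes "n \<ge> 1"
    and "a \<in> hex_vertices n" and "b \<in> hex_vertices n" and "a \<noteq> b"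
  shows "hex_resistance n (P 0) (Q n) \<ge> hex_resistance n a b \<and>
         hex_resistance n a b \<ge> hex_resistance n (P (n div 2)) (Q (n div 2))"
proof -
  define j where "j = hex_pos a"
  define k where "k = hex_pos b"
  have jk: "j \<le> 2 * n" "k \<le> 2 * n"
    using assms by (auto simp: j_def k_def hex_vertices_iff)
  have r: "2 * hex_resistance n a b = \<bar>real j - real k\<bar> + green n j j + green n k k
      - 2 * (hex_side a * hex_side b) * green n j k"
    using hex_resistance_eq[OF assms(2,3)] by (simp add: j_def k_def)
  have side: "hex_side a * hex_side b = 1 \<or> hex_side a * hex_side b = -1"
    by (cases a; cases b) auto
  have ends: "green n (2 * n) (2 * n) = green n 0 0"
    using green_reflect[of 0 n 0] by simp
  have max: "2 * hex_resistance n (P 0) (Q n) = 2 * n + 2 * green n 0 0 + 2 * green n 0 (2 * n)"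
    using hex_resistance_eq[of "P 0" n "Q n"] by (simp add: hex_vertices_iff ends)
  have min: "2 * hex_resistance n (P (n div 2)) (Q (n div 2)) =
      4 * green n (2 * (n div 2)) (2 * (n div 2))"
    using hex_resistance_eq[of "P (n div 2)" n "Q (n div 2)"] by (simp add: hex_vertices_iff)
  \<comment> \<open>As \<open>green\<close> is positive, the opposite-side value bounds the
    same-side value; for the minimum the roles are exchanged.\<close>
  have "2 * hex_resistance n a b \<le> 2 * hex_resistance n (P 0) (Q n)"
    using opposite_resistance_le[OF assms(1) jk] side green_pos[of n j k] unfolding r max by auto
  moreover have "2 * hex_resistance n (P (n div 2)) (Q (n div 2)) \<le> 2 * hex_resistance n a b"
  proof (cases "j = k")
    case False
    then show ?thesis
      using middle_le_distinct_positions[OF assms(1) jk] side green_pos[of n j k]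
      unfolding r min by auto
  next
    case True
    then have "hex_side a * hex_side b = -1"
      using hex_vertex_eqI[of a b] assms(4) side by (cases a; cases b) (auto simp: j_def k_def)
    then have r': "2 * hex_resistance n a b = 4 * green n j j"
      unfolding r using True by simp
    show ?thesis
    proof (cases "even j")
      case True
      then show ?thesis
        using green_rung_ge_middle[of "j div 2" n] jk unfolding r' min by auto
    next
      case False
      then have "j < 2 * n"
        using jk by (auto intro: le_neq_implies_less)
      \<comment> \<open>For a pair \<open>U i\<close>, \<open>V i\<close> the left-hand resistance
        doubled exceeds 2, whereas the middle rung gives at most
        \<open>4 * 5/12 = 5/3\<close>.\<close>
      then show ?thesis
        using green_odd_diag[OF False] green_pos[of n "j - 1" "j - 1"] green_pos[of n "j - 1" "j + 1"]
          green_pos[of n "j + 1" "j + 1"] green_rung_le[OF assms(1), of "n div 2"]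
        unfolding r' min by simp
    qed
  qed
  ultimately show ?thesis
    by simp
qed

end
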